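(* There exists $\boldsymbol w_0\in BV_{\mathrm{rad}}(I,\mathbb S^2)$ such that the functional $\mathcal F_{\boldsymbol w_0}:L^2(I,\mathbb S^2)\to[0,+\infty]$ defined by $$\mathcal F_{\boldsymbol w_0}(\boldsymbol u)=\begin{cases}|\boldsymbol u_x|_{\mathbb S^2}(I)&\text{if }\boldsymbol u\in BV(I,\mathbb S^2)\text{ and }|\boldsymbol u_x|_{\mathbb S^2}\le|(\boldsymbol w_0)_x|_{\mathbb S^2}\text{ as measures},\\+\infty&\text{otherwise}\end{cases}$$ is not geodesically semiconvex.
   Context: $I\subset\mathbb R$ is a bounded open interval; $\mathbb S^2\subset\mathbb R^3$ is the unit sphere with geodesic distance $\mathrm{dist}_{\mathbb S^2}$. $X=L^2(I,\mathbb S^2)$ is equipped with the distance $d(\boldsymbol u,\boldsymbol v)^2=\int_I\mathrm{dist}_{\mathbb S^2}^2(\boldsymbol u(x),\boldsymbol v(x))\,dx$. $BV(I,\mathbb S^2)$ is the set of $\boldsymbol w\in BV(I,\mathbb R^3)$ with values in $\mathbb S^2$ a.e.; for such $\boldsymbol w$, with one-sided limits $\boldsymbol w^\pm$, jump set $J_{\boldsymbol w}$ and $\boldsymbol w_x^d$ the diffuse (non-atomic) part of the derivative measure, $$|\boldsymbol w_x|_{\mathbb S^2}(A)=|\boldsymbol w_x^d|(A)+\sum_{x\in A\cap J_{\boldsymbol w}}\mathrm{dist}_{\mathbb S^2}(\boldsymbol w^-(x),\boldsymbol w^+(x)).$$ $BV_{\mathrm{rad}}(I,\mathbb S^2)$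 is the set of $\boldsymbol w\in BV(I,\mathbb S^2)$ with $\mathrm{dist}_{\mathbb S^2}(\boldsymbol w^-(x),\boldsymbol w^+(x))<\pi$ for all $x\in I$. In a metric space $(X,d)$, a curve $[0,1]\ni t\mapsto\boldsymbol\gamma_t\in X$ is a constant speed geodesic if $d(\boldsymbol\gamma_s,\boldsymbol\gamma_t)=|t-s|\,d(\boldsymbol\gamma_0,\boldsymbol\gamma_1)$ for all $s,t\in[0,1]$. A functional $\mathcal F:X\to\,]-\infty,+\infty]$ is geodesically $\lambda$-convex ($\lambda\in\mathbb R$) if for all $\boldsymbol u,\boldsymbol v\in X$ there is a constant speed geodesic $\boldsymbol\gamma_t$ from $\boldsymbol u$ to $\boldsymbol v$ with $\mathcal F(\boldsymbol\gamma_t)\le(1-t)\mathcal F(\boldsymbol u)+t\mathcal F(\boldsymbol v)-\frac12\lambda t(1-t)d^2(\boldsymbol u,\boldsymbol v)$ for all $t\in[0,1]$. $\mathcal F$ is geodesically semiconvex if it is geodesically $\lambda$-convex for some $\lambda\in\mathbb R$. *)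

theory Defs
  imports "HOL-Analysis.Analysis"
begin

definition constant_speed_geodesic ::
    "'a set \<Rightarrow> ('a \<Rightarrow> 'a \<Rightarrow> real) \<Rightarrow> (real \<Rightarrow> 'a) \<Rightarrow> bool" where
  "constant_speed_geodesic X d \<gamma> \<longleftrightarrow>
     (\<forall>t\<in>{0..1}. \<gamma> t \<in> X) \<and>
     (\<forall>s\<in>{0..1}. \<forall>t\<in>{0..1}. d (\<gamma> s) (\<gamma> t) = \<bar>t - s\<bar> * d (\<gamma> 0) (\<gamma> 1))"

text \<open>Functionals take values in \<open>]-\<infinity>, +\<infinity>]\<close>; for these the right-hand side below never involves
  \<open>\<infinity> - \<infinity>\<close>, and the convention \<open>0 * \<infinity> = 0\<close> makes the inequality trivial at \<open>t = 0\<close> and \<open>t = 1\<close>.\<close>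

definition geodesically_convex ::
    "'a set \<Rightarrow> ('a \<Rightarrow> 'a \<Rightarrow> real) \<Rightarrow> real \<Rightarrow> ('a \<Rightarrow> ereal) \<Rightarrow> bool" where
  "geodesically_convex X d lam F \<longleftrightarrow>
     (\<forall>u\<in>X. \<forall>v\<in>X. \<exists>\<gamma>. constant_speed_geodesic X d \<gamma> \<and> \<gamma> 0 = u \<and> \<gamma> 1 = v \<and>
        (\<forall>t\<in>{0..1}. F (\<gamma> t) \<le> ereal (1 - t) * F u + ereal t * F v
                              - ereal (1 / 2 * lam * t * (1 - t) * (d u v)\<^sup>2)))"

definition geodesically_semiconvex ::
    "'a set \<Rightarrow> ('a \<Rightarrow> 'a \<Rightarrow> real) \<Rightarrow> ('a \<Rightarrow> ereal) \<Rightarrow> bool" where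
  "geodesically_semiconvex X d F \<longleftrightarrow> (\<exists>lam. geodesically_convex X d lam F)"

abbreviation S2 :: "(real^3) set" where
  "S2 \<equiv> sphere 0 1"

text \<open>Geodesic (great-circle) distance on the unit sphere: the angle between two unit vectors.\<close>

definition dist_S2 :: "real^3 \<Rightarrow> real^3 \<Rightarrow> real" where
  "dist_S2 p q = arccos (p \<bullet> q)"

text \<open>Lebesgue spaces are represented by functions rather than by classes
  modulo a.e. equality. Square integrability is automatic on a bounded interval, since the maps are
  a.e. bounded. The distance below is then only a pseudometric; it vanishes exactly when the
  functions agree a.e. on \<open>I\<close>. Everything below depends only on the a.e. class of a function, and a
  geodesic between classes can be represented by a curve with prescribed representatives at its
  endpoints, so geodesic convexity has the same meaning as on the quotient.\<close>

definition L2_S2 :: "real set \<Rightarrow> (real \<Rightarrow> real^3) set" where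
  "L2_S2 I = {u. u \<in> borel_measurable (lebesgue_on I) \<and> (AE x in lebesgue_on I. u x \<in> S2)}"

definition dist_L2_S2 :: "real set \<Rightarrow> (real \<Rightarrow> real^3) \<Rightarrow> (real \<Rightarrow> real^3) \<Rightarrow> real" where
  "dist_L2_S2 I u v = sqrt (\<integral>x. (dist_S2 (u x) (v x))\<^sup>2 \<partial>lebesgue_on I)"

definition test_function :: "real set \<Rightarrow> (real \<Rightarrow> real) \<Rightarrow> bool" where
  "test_function I \<phi> \<longleftrightarrow> \<phi> C1_differentiable_on UNIV \<and>
     (\<exists>K. compact K \<and> K \<subseteq> I \<and> (\<forall>x. x \<notin> K \<longrightarrow> \<phi> x = 0))"

text \<open>A finite \<open>\<real>\<^sup>3\<close>-valued Borel measure on \<open>I\<close> is given by its polar decomposition \<open>\<sigma> \<nu>\<close>: a finite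
  positive Borel measure \<open>\<nu>\<close> on \<open>I\<close>, which is its total variation measure, and a density \<open>\<sigma>\<close> of unit
  length \<open>\<nu>\<close>-a.e. The predicate says that the distributional derivative of \<open>w\<close> on \<open>I\<close> is \<open>\<sigma> \<nu>\<close>.\<close>

definition has_derivative_measure ::
    "real set \<Rightarrow> (real \<Rightarrow> real^3) \<Rightarrow> real measure \<Rightarrow> (real \<Rightarrow> real^3) \<Rightarrow> bool" where
  "has_derivative_measure I w \<nu> \<sigma> \<longleftrightarrow>
     sets \<nu> = sets (restrict_space borel I) \<and> finite_measure \<nu> \<and>
     \<sigma> \<in> borel_measurable \<nu> \<and> (AE x in \<nu>. norm (\<sigma> x) = 1) \<and>
     (\<forall>\<phi>. test_function I \<phi> \<longrightarrow>
        (\<integral>x. deriv \<phi> x *\<^sub>R w x \<partial>lebesgue_on I) = - (\<integral>x. \<phi> x *\<^sub>R \<sigma> x \<partial>\<nu>))"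

definition BV :: "real set \<Rightarrow> (real \<Rightarrow> real^3) set" where
  "BV I = {w. integrable (lebesgue_on I) w \<and> (\<exists>\<nu> \<sigma>. has_derivative_measure I w \<nu> \<sigma>)}"

definition BV_S2 :: "real set \<Rightarrow> (real \<Rightarrow> real^3) set" where
  "BV_S2 I = {w \<in> BV I. AE x in lebesgue_on I. w x \<in> S2}"

text \<open>The total variation measure \<open>|w\<^sub>x|\<close> of the derivative; it is uniquely determined for \<open>w \<in> BV I\<close>.\<close>

definition var_measure :: "real set \<Rightarrow> (real \<Rightarrow> real^3) \<Rightarrow> real measure" where
  "var_measure I w = (SOME \<nu>. \<exists>\<sigma>. has_derivative_measure I w \<nu> \<sigma>)"

text \<open>The diffuse part \<open>w\<^sub>x\<^sup>d\<close> is the restriction of \<open>w\<^sub>x\<close> to the complement of its atoms, so its total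
  variation is the corresponding restriction of \<open>|w\<^sub>x|\<close>.\<close>

definition diffuse_var :: "real set \<Rightarrow> (real \<Rightarrow> real^3) \<Rightarrow> real set \<Rightarrow> ennreal" where
  "diffuse_var I w A =
     emeasure (var_measure I w) (A - {x\<in>I. emeasure (var_measure I w) {x} \<noteq> 0})"

text \<open>One-sided limits up to null sets, i.e. those of the good representative of \<open>w\<close>.\<close>

definition left_lim :: "(real \<Rightarrow> real^3) \<Rightarrow> real \<Rightarrow> real^3" where
  "left_lim w x = Lim (inf (at_left x) (ae_filter lebesgue)) w"

definition right_lim :: "(real \<Rightarrow> real^3) \<Rightarrow> real \<Rightarrow> real^3" where
  "right_lim w x = Lim (inf (at_right x) (ae_filter lebesgue)) w"

definition jump_set :: "real set \<Rightarrow> (real \<Rightarrow> real^3) \<Rightarrow> real set" where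
  "jump_set I w = {x\<in>I. left_lim w x \<noteq> right_lim w x}"

definition var_S2 :: "real set \<Rightarrow> (real \<Rightarrow> real^3) \<Rightarrow> real set \<Rightarrow> ennreal" where
  "var_S2 I w A = diffuse_var I w A +
     (\<Sum>\<^sub>\<infinity>x\<in>A \<inter> jump_set I w. ennreal (dist_S2 (left_lim w x) (right_lim w x)))"

definition BV_rad :: "real set \<Rightarrow> (real \<Rightarrow> real^3) set" where
  "BV_rad I = {w \<in> BV_S2 I. \<forall>x\<in>I. dist_S2 (left_lim w x) (right_lim w x) < pi}"

definition constrained_TV :: "real set \<Rightarrow> (real \<Rightarrow> real^3) \<Rightarrow> (real \<Rightarrow> real^3) \<Rightarrow> ereal" where
  "constrained_TV I w\<^sub>0 u =
     (if u \<in> BV_S2 I \<and> (\<forall>A\<in>sets borel. A \<subseteq> I \<longrightarrow> var_S2 I u A \<le> var_S2 I w\<^sub>0 A)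
      then enn2ereal (var_S2 I u I) else \<infinity>)"

end

theory Submission
  imports Defs "HOL-Probability.Giry_Monad"
begin

text \<open>The counterexample has one jump. Let \<open>w\<^sub>0\<close> take two values \<open>p\<close> and \<open>q\<close> on the northern
  hemisphere, of latitude \<open>pi / 4\<close> and with longitudes that differ by \<open>pi / 2\<close>, and let \<open>v\<close> be the
  mirror image of \<open>w\<^sub>0\<close> in the equatorial plane. Reflection is an isometry, so \<open>v\<close> has the same
  variation measure as \<open>w\<^sub>0\<close>, and both maps are admissible with the same finite energy.
  Meridians diverge on their way to the equator: halfway between \<open>w\<^sub>0\<close> and \<open>v\<close> the two values lie on
  the equator, and the jump has grown from \<open>pi / 3\<close> to \<open>pi / 2\<close>. The constraint by the variation of
  \<open>w\<^sub>0\<close> fails at the jump point, the energy of the midpoint is infinite, and no quadratic correction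
  in the definition of \<open>\<lambda>\<close>-convexity can absorb an infinite value.

  Two points need an argument. First, the midpoint must be the same for every geodesic. A
  midpoint in \<open>L\<^sup>2\<close> is a pointwise midpoint almost everywhere
  (\<open>L2_midpoint_of_orthogonal_maps\<close>), and a point and its mirror image have a unique midpoint as they
  are at distance \<open>pi / 2\<close> (\<open>sum_squares_angles_orthonormal\<close>).

  Second, the variation measures must be compared. An orthogonal transformation changes the
  density of the derivative but not its total variation measure, so \<open>w\<^sub>0\<close> and \<open>v\<close> share the diffuse
  part of the variation (\<open>diffuse_var_orthogonal\<close>); and the violated constraint is tested on the
  jump point alone, which the diffuse part does not charge (\<open>var_S2_singleton\<close>).\<close>

section \<open>Angles on the sphere\<close>

text \<open>Bessel's inequality gives the triangle inequality \<open>x + y \<ge> pi / 2\<close> for the two angles, and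
  \<open>x\<^sup>2 + y\<^sup>2 = ((x + y)\<^sup>2 + (x - y)\<^sup>2) / 2\<close>. Equality forces \<open>x = y = pi / 4\<close>, and then \<open>m\<close> has inner
  product \<open>1\<close> with the unit vector in the direction \<open>p + q\<close>.\<close>

lemma sum_squares_angles_orthonormal:
  fixes p q m :: "real^3"
  assumes u: "norm p = 1" "norm q = 1" "norm m = 1" and o: "p \<bullet> q = 0"
  shows "pi\<^sup>2 / 8 \<le> (dist_S2 p m)\<^sup>2 + (dist_S2 m q)\<^sup>2"
    and "(dist_S2 p m)\<^sup>2 + (dist_S2 m q)\<^sup>2 = pi\<^sup>2 / 8 \<Longrightarrow> m = (1 / sqrt 2) *\<^sub>R (p + q)"
proof -
  define \<alpha> \<beta> where "\<alpha> = p \<bullet> m" and "\<beta> = m \<bullet> q"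
  have n: "p \<bullet> p = 1" "q \<bullet> q = 1" "m \<bullet> m = 1"
    using u by (simp_all add: norm_eq_1)
  have "0 \<le> (m - \<alpha> *\<^sub>R p - \<beta> *\<^sub>R q) \<bullet> (m - \<alpha> *\<^sub>R p - \<beta> *\<^sub>R q)"
    by (rule inner_ge_zero)
  also have "\<dots> = 1 - \<alpha>\<^sup>2 - \<beta>\<^sup>2"
    using n o by (simp add: \<alpha>_def \<beta>_def inner_diff_left inner_diff_right inner_commute
        power2_eq_square algebra_simps)
  finally have bessel: "\<alpha>\<^sup>2 + \<beta>\<^sup>2 \<le> 1" by simp
  have "\<alpha>\<^sup>2 \<le> 1" "\<beta>\<^sup>2 \<le> 1"
    using bessel zero_le_power2[of \<alpha>] zero_le_power2[of \<beta>] by linarith+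
  then have \<alpha>: "-1 \<le> \<alpha>" "\<alpha> \<le> 1" and \<beta>: "-1 \<le> \<beta>" "\<beta> \<le> 1"
    by (auto simp: abs_le_iff abs_square_le_1)
  define x y where "x = arccos \<alpha>" and "y = arccos \<beta>"
  have xy: "dist_S2 p m = x" "dist_S2 m q = y"
    by (simp_all add: dist_S2_def x_def y_def \<alpha>_def \<beta>_def)
  have x: "0 \<le> x" "x \<le> pi" "cos x = \<alpha>" and y: "0 \<le> y" "y \<le> pi" "cos y = \<beta>"
    using \<alpha> \<beta> by (auto simp: x_def y_def arccos_lbound arccos_ubound)
  have sum_ge: "pi / 2 \<le> x + y"
  proof (rule ccontr)
    assume "\<not> pi / 2 \<le> x + y"
    then have lt: "x < pi / 2 - y" "pi / 2 - y \<le> pi" using y by auto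
    then have "cos (pi / 2 - y) < cos x"
      using x by (intro cos_monotone_0_pi) auto
    moreover have "0 \<le> sin y" using y by (simp add: sin_ge_zero)
    ultimately have "(sin y)\<^sup>2 < \<alpha>\<^sup>2"
      using x by (simp add: cos_diff power_strict_mono)
    then show False using bessel y sin_cos_squared_add[of y] by auto
  qed
  have split: "x\<^sup>2 + y\<^sup>2 = (x + y)\<^sup>2 / 2 + (x - y)\<^sup>2 / 2"
    by (simp add: power2_eq_square field_simps)
  have sq: "(pi / 2)\<^sup>2 \<le> (x + y)\<^sup>2"
    using sum_ge by (intro power_mono) auto
  show "pi\<^sup>2 / 8 \<le> (dist_S2 p m)\<^sup>2 + (dist_S2 m q)\<^sup>2"
  proof -
    have "pi\<^sup>2 / 8 \<le> (x + y)\<^sup>2 / 2" using sq by (simp add: power_divide)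
    then show ?thesis
      unfolding xy split using zero_le_power2[of "x - y"] by linarith
  qed
  assume "(dist_S2 p m)\<^sup>2 + (dist_S2 m q)\<^sup>2 = pi\<^sup>2 / 8"
  then have eq: "(x + y)\<^sup>2 / 2 + (x - y)\<^sup>2 / 2 = pi\<^sup>2 / 8" unfolding xy split .
  moreover have "pi\<^sup>2 / 8 = (pi / 2)\<^sup>2 / 2" by (simp add: power_divide)
  ultimately have "(x - y)\<^sup>2 \<le> 0" and e2: "(x + y)\<^sup>2 \<le> (pi / 2)\<^sup>2"
    using sq zero_le_power2[of "x - y"] by linarith+
  then have "x = y" by simp
  moreover from e2 have "x + y \<le> pi / 2" by (rule power2_le_imp_le) simp
  ultimately have xv: "x = pi / 4" and yv: "y = pi / 4" using sum_ge by auto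
  then have ab: "\<alpha> = sqrt 2 / 2" "\<beta> = sqrt 2 / 2"
    using x(3)[unfolded xv] y(3)[unfolded yv] by (simp_all add: cos_45)
  define r where "r = (1 / sqrt 2) *\<^sub>R (p + q)"
  have rr: "r \<bullet> r = 1"
    using n o by (simp add: r_def inner_add_left inner_add_right inner_commute)
  have "m \<bullet> r = (\<alpha> + \<beta>) / sqrt 2"
    by (simp add: r_def \<alpha>_def \<beta>_def inner_add_right inner_commute)
  then have mr: "m \<bullet> r = 1" by (simp add: ab)
  have "(m - r) \<bullet> (m - r) = 0"
    using n rr mr by (simp add: inner_diff_left inner_diff_right inner_commute)
  then show "m = (1 / sqrt 2) *\<^sub>R (p + q)" by (simp add: r_def)
qed

section \<open>Midpoints of square integrable maps into the sphere\<close>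

text \<open>Outside \<open>{-1..1}\<close> the value of \<open>arccos\<close> is one fixed unspecified number.\<close>

lemma borel_measurable_arccos: "arccos \<in> borel_measurable borel"
proof -
  have eq: "arccos = (\<lambda>y. if y \<in> {-1..1} then arccos (max (-1) (min 1 y)) else (THE x. False))"
  proof
    fix y :: real
    have "arccos y = (THE x. False)" if "y \<notin> {-1..1}"
    proof -
      have "(\<lambda>x. 0 \<le> x \<and> x \<le> pi \<and> cos x = y) = (\<lambda>x. False)"
        using that by auto
      then show ?thesis unfolding arccos_def by (rule arg_cong)
    qed
    then show "arccos y = (if y \<in> {-1..1} then arccos (max (-1) (min 1 y)) else (THE x. False))"
      by (auto simp: max_def min_def)
  qed
  have "continuous_on UNIV (\<lambda>y::real. arccos (max (-1) (min 1 y)))"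
    by (intro continuous_intros) auto
  then have "(\<lambda>y::real. arccos (max (-1) (min 1 y))) \<in> borel_measurable borel"
    by (rule borel_measurable_continuous_onI)
  then have "(\<lambda>y. if y \<in> {-1..1} then arccos (max (-1) (min 1 y)) else (THE x. False))
      \<in> borel_measurable borel"
    by (rule measurable_If_set) auto
  then show ?thesis by (subst eq)
qed

lemma integrable_dist_S2_squared:
  assumes "I \<in> lmeasurable" and u: "u \<in> L2_S2 I" and v: "v \<in> L2_S2 I"
  shows "integrable (lebesgue_on I) (\<lambda>x. (dist_S2 (u x) (v x))\<^sup>2)"
proof -
  interpret finite_measure "lebesgue_on I"
    using assms(1) by (rule finite_measure_lebesgue_on)
  have [measurable]: "u \<in> borel_measurable (lebesgue_on I)" "v \<in> borel_measurable (lebesgue_on I)"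
    using u v by (auto simp: L2_S2_def)
  note [measurable] = borel_measurable_arccos
  have "AE x in lebesgue_on I. u x \<in> S2" "AE x in lebesgue_on I. v x \<in> S2"
    using u v by (auto simp: L2_S2_def)
  then have "AE x in lebesgue_on I. norm ((dist_S2 (u x) (v x))\<^sup>2) \<le> pi\<^sup>2"
  proof eventually_elim
    case (elim x)
    then have "\<bar>u x \<bullet> v x\<bar> \<le> 1" using Cauchy_Schwarz_ineq2[of "u x" "v x"] by simp
    then show ?case
      by (auto simp: dist_S2_def abs_le_iff intro!: power_mono arccos_lbound arccos_ubound)
  qed
  then show ?thesis
    by (rule integrable_const_bound) (simp add: dist_S2_def)
qed

text \<open>The two squared distances from a midpoint to the endpoints add up to half the squared distance
  of the endpoints. Hence the nonnegative defect in \<open>sum_squares_angles_orthonormal\<close> has integral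
  zero, and equality holds in that inequality almost everywhere.\<close>

lemma L2_midpoint_of_orthogonal_maps:
  assumes I: "I \<in> lmeasurable"
    and mem: "u \<in> L2_S2 I" "v \<in> L2_S2 I" "m \<in> L2_S2 I"
    and o: "AE x in lebesgue_on I. u x \<bullet> v x = 0"
    and um: "dist_L2_S2 I u m = dist_L2_S2 I u v / 2"
    and mv: "dist_L2_S2 I m v = dist_L2_S2 I u v / 2"
  shows "AE x in lebesgue_on I. m x = (1 / sqrt 2) *\<^sub>R (u x + v x)"
proof -
  let ?M = "lebesgue_on I"
  interpret finite_measure ?M using I by (rule finite_measure_lebesgue_on)
  note int = integrable_dist_S2_squared[OF I]
  have sq: "(dist_L2_S2 I f g)\<^sup>2 = (\<integral>x. (dist_S2 (f x) (g x))\<^sup>2 \<partial>?M)" for f g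
    by (simp add: dist_L2_S2_def)
  have "(\<integral>x. (dist_S2 (u x) (v x))\<^sup>2 \<partial>?M) = (\<integral>x. (pi / 2)\<^sup>2 \<partial>?M)"
    using o int[OF mem(1,2)] by (intro integral_cong_AE) (auto simp: dist_S2_def)
  then have D: "(dist_L2_S2 I u v)\<^sup>2 = (\<integral>x. (pi / 2)\<^sup>2 \<partial>?M)"
    by (simp only: sq)
  define g where "g = (\<lambda>x. (dist_S2 (u x) (m x))\<^sup>2 + (dist_S2 (m x) (v x))\<^sup>2 - pi\<^sup>2 / 8)"
  have ig: "integrable ?M g"
    unfolding g_def using int mem by auto
  have "integral\<^sup>L ?M g = (dist_L2_S2 I u m)\<^sup>2 + (dist_L2_S2 I m v)\<^sup>2 - (\<integral>x. pi\<^sup>2 / 8 \<partial>?M)"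
    unfolding g_def sq using int mem by simp
  also have "\<dots> = 0"
    using D unfolding um mv by (simp add: power_divide field_simps)
  finally have g0: "integral\<^sup>L ?M g = 0" .
  have S: "AE x in ?M. u x \<in> S2" "AE x in ?M. v x \<in> S2" "AE x in ?M. m x \<in> S2"
    using mem by (auto simp: L2_S2_def)
  have "AE x in ?M. 0 \<le> g x"
    using S o by eventually_elim (use sum_squares_angles_orthonormal(1) in \<open>auto simp: g_def\<close>)
  then have "AE x in ?M. g x = 0"
    using integral_nonneg_eq_0_iff_AE[OF ig] g0 by simp
  then show ?thesis
    using S o
    by eventually_elim (intro sum_squares_angles_orthonormal(2), auto simp: g_def)
qed

section \<open>One-sided limits of step functions\<close>

definition step :: "real \<Rightarrow> 'a \<Rightarrow> 'a \<Rightarrow> real \<Rightarrow> 'a" where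
  "step c p q x = (if x < c then p else q)"

text \<open>An interval is not a null set. This nontriviality makes one-sided limits modulo null sets
  unique.\<close>

lemma inf_ae_filter_lebesgue_nontrivial:
  fixes F :: "real filter"
  assumes "\<And>P. eventually P F \<Longrightarrow> \<exists>s t. s < t \<and> (\<forall>y\<in>{s<..<t}. P y)"
  shows "inf F (ae_filter lebesgue) \<noteq> bot"
proof
  assume "inf F (ae_filter lebesgue) = bot"
  then have "eventually (\<lambda>_. False) (inf F (ae_filter lebesgue))" by simp
  then obtain P Q where P: "eventually P F" and Q: "AE x in lebesgue. Q x"
    and PQ: "\<And>x. P x \<Longrightarrow> Q x \<Longrightarrow> False"
    by (auto simp: eventually_inf)
  from assms[OF P] obtain s t where st: "s < t" "\<And>y. y \<in> {s<..<t} \<Longrightarrow> P y" by auto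
  have "AE x in lebesgue. x \<notin> {s<..<t}"
    using Q by eventually_elim (use st PQ in blast)
  then have "emeasure lebesgue {s<..<t} = 0"
    by (subst (asm) AE_iff_measurable[where N = "{s<..<t}"]) auto
  then show False using st(1) by simp
qed

lemma left_lim_AE_eqI:
  assumes "s < x" "AE y in lebesgue. s < y \<and> y < x \<longrightarrow> w y = l"
  shows "left_lim w x = l"
proof -
  have "inf (at_left x) (ae_filter lebesgue) \<noteq> bot"
  proof (rule inf_ae_filter_lebesgue_nontrivial)
    fix P assume "eventually P (at_left x)"
    then obtain s where "s < x" "\<forall>y>s. y < x \<longrightarrow> P y" by (auto simp: eventually_at_left_field)
    then have "s < x \<and> (\<forall>y\<in>{s<..<x}. P y)" by simp
    then show "\<exists>s t. s < t \<and> (\<forall>y\<in>{s<..<t}. P y)" by blast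
  qed
  moreover have "\<forall>\<^sub>F y in at_left x. s < y \<and> y < x"
    using assms(1) by (auto simp: eventually_at_left_field)
  then have "\<forall>\<^sub>F y in inf (at_left x) (ae_filter lebesgue). w y = l"
    unfolding eventually_inf using assms(2) by blast
  ultimately show ?thesis
    unfolding left_lim_def by (intro tendsto_Lim tendsto_eventually) auto
qed

lemma right_lim_AE_eqI:
  assumes "x < t" "AE y in lebesgue. x < y \<and> y < t \<longrightarrow> w y = l"
  shows "right_lim w x = l"
proof -
  have "inf (at_right x) (ae_filter lebesgue) \<noteq> bot"
  proof (rule inf_ae_filter_lebesgue_nontrivial)
    fix P assume "eventually P (at_right x)"
    then obtain t where "x < t" "\<forall>y>x. y < t \<longrightarrow> P y" by (auto simp: eventually_at_right_field)
    then have "x < t \<and> (\<forall>y\<in>{x<..<t}. P y)" by simp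
    then show "\<exists>s t. s < t \<and> (\<forall>y\<in>{s<..<t}. P y)" by blast
  qed
  moreover have "\<forall>\<^sub>F y in at_right x. x < y \<and> y < t"
    using assms(1) by (auto simp: eventually_at_right_field)
  then have "\<forall>\<^sub>F y in inf (at_right x) (ae_filter lebesgue). w y = l"
    unfolding eventually_inf using assms(2) by blast
  ultimately show ?thesis
    unfolding right_lim_def by (intro tendsto_Lim tendsto_eventually) auto
qed

lemma one_sided_limits_AE_step:
  assumes w: "AE y in lebesgue_on {a<..<b}. w y = step c p q y" and x: "x \<in> {a<..<b}"
  shows "left_lim w x = (if x \<le> c then p else q)" and "right_lim w x = (if x < c then p else q)"
proof -
  have w': "AE y in lebesgue. y \<in> {a<..<b} \<longrightarrow> w y = step c p q y"
    using w by (simp add: AE_restrict_space_iff)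
  show "left_lim w x = (if x \<le> c then p else q)"
  proof (rule left_lim_AE_eqI[where s = "if x \<le> c then a else max a c"])
    show "AE y in lebesgue. (if x \<le> c then a else max a c) < y \<and> y < x \<longrightarrow>
        w y = (if x \<le> c then p else q)"
      using w' by eventually_elim (use x in \<open>auto simp: step_def\<close>)
  qed (use x in auto)
  show "right_lim w x = (if x < c then p else q)"
  proof (rule right_lim_AE_eqI[where t = "if x < c then min b c else b"])
    show "AE y in lebesgue. x < y \<and> y < (if x < c then min b c else b) \<longrightarrow>
        w y = (if x < c then p else q)"
      using w' by eventually_elim (use x in \<open>auto simp: step_def split: if_splits\<close>)
  qed (use x in auto)
qed

text \<open>The diffuse part does not charge a point: an atom is removed from it, and any other point has
  measure zero.\<close>

lemma var_S2_singleton: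
  assumes "c \<in> I"
  shows "var_S2 I w {c} = (if left_lim w c = right_lim w c then 0
           else ennreal (dist_S2 (left_lim w c) (right_lim w c)))"
proof -
  have "diffuse_var I w {c} = 0"
  proof (cases "emeasure (var_measure I w) {c} = 0")
    case True
    then have "{c} - {x\<in>I. emeasure (var_measure I w) {x} \<noteq> 0} = {c}" by auto
    then show ?thesis using True by (simp only: diffuse_var_def)
  next
    case False
    then have "{c} - {x\<in>I. emeasure (var_measure I w) {x} \<noteq> 0} = {}" using assms by auto
    then show ?thesis by (simp only: diffuse_var_def emeasure_empty)
  qed
  moreover have "{c} \<inter> jump_set I w = (if left_lim w c = right_lim w c then {} else {c})"
    using assms by (auto simp: jump_set_def)
  ultimately show ?thesis by (simp add: var_S2_def)
qed

lemma jump_set_step: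
  assumes "c \<in> {a<..<b}" "p \<noteq> q"
  shows "jump_set {a<..<b} (step c p q) = {c}"
  using assms one_sided_limits_AE_step[where w = "step c p q" and a = a and b = b
      and c = c and p = p and q = q]
  by (auto simp: jump_set_def split: if_splits)

section \<open>Step functions have bounded variation\<close>

lemma step_borel_measurable:
  fixes p q :: "real^3"
  shows "step c p q \<in> borel_measurable (lebesgue_on I)"
proof -
  have "step c p q \<in> borel_measurable borel" unfolding step_def by measurable
  then have "step c p q \<in> borel_measurable lebesgue"
    by (intro measurable_completion) simp
  then show ?thesis by (rule measurable_restrict_space1)
qed

lemma step_in_L2_S2:
  assumes "norm p = 1" "norm q = 1"
  shows "step c p q \<in> L2_S2 I"
proof -
  have "AE x in lebesgue_on I. step c p q x \<in> S2"
    by (intro AE_I2) (use assms in \<open>auto simp: step_def\<close>)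
  then show ?thesis by (simp add: L2_S2_def step_borel_measurable)
qed

text \<open>Integration by parts on the two sides of \<open>c\<close> leaves the boundary terms at \<open>c\<close>, that is, the
  jump \<open>q - p\<close> times a Dirac mass. The polar decomposition splits the jump into its length and its
  direction; for \<open>p = q\<close> the measure vanishes and the direction \<open>sgn 0 = 0\<close> is harmless.\<close>

lemma has_derivative_measure_step:
  fixes p q :: "real^3"
  assumes c: "c \<in> {a<..<b}"
  shows "has_derivative_measure {a<..<b} (step c p q)
    (density (return (restrict_space borel {a<..<b}) c) (\<lambda>_. norm (q - p))) (\<lambda>_. sgn (q - p))"
proof -
  let ?I = "{a<..<b}"
  let ?R = "return (restrict_space borel ?I) c"
  let ?n = "density ?R (\<lambda>_. ennreal (norm (q - p)))"
  have cI: "c \<in> space (restrict_space borel ?I)" using c by (simp add: space_restrict_space)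
  interpret R: prob_space ?R by (rule prob_space_return[OF cI])
  have fin: "finite_measure ?n"
  proof (rule finite_measureI)
    have "emeasure ?n (space ?R) = ennreal (norm (q - p)) * emeasure ?R (space ?R)"
      by (intro emeasure_density_const) (rule sets.top)
    then show "emeasure ?n (space ?n) \<noteq> \<infinity>"
      by (simp only: R.emeasure_space_1 space_density) simp
  qed
  have unit: "AE x in ?n. norm (sgn (q - p)) = 1"
    by (simp add: AE_density norm_sgn)
  have "(\<integral>x. deriv \<phi> x *\<^sub>R step c p q x \<partial>lebesgue_on ?I) = - (\<integral>x. \<phi> x *\<^sub>R sgn (q - p) \<partial>?n)"
    if \<phi>: "test_function ?I \<phi>" for \<phi>
  proof -
    from \<phi> obtain D where D: "\<And>x. (\<phi> has_vector_derivative D x) (at x)" "continuous_on UNIV D"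
      by (auto simp: test_function_def C1_differentiable_on_def)
    have dphi: "deriv \<phi> = D"
      by (intro ext DERIV_imp_deriv
          has_real_derivative_iff_has_vector_derivative[THEN iffD2] D(1))
    from \<phi> have zero: "\<phi> a = 0" "\<phi> b = 0" by (auto simp: test_function_def)
    have cont: "continuous_on UNIV \<phi>"
      using D(1) by (meson continuous_at_imp_continuous_on has_vector_derivative_continuous)
    then have [measurable]: "\<phi> \<in> borel_measurable borel" by (rule borel_measurable_continuous_onI)
    \<comment> \<open>The constant makes this piecewise antiderivative continuous at \<open>c\<close>.\<close>
    define \<Phi> where
      "\<Phi> = (\<lambda>x. if x \<le> c then \<phi> x *\<^sub>R p else \<phi> x *\<^sub>R q + \<phi> c *\<^sub>R (p - q))"
    have hi: "((\<lambda>x. D x *\<^sub>R step c p q x) has_integral (\<Phi> b - \<Phi> a)) {a..b}"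
    proof (rule fundamental_theorem_of_calculus_interior_strong[where S = "{c}"])
      fix x assume x: "x \<in> {a<..<b} - {c}"
      consider "x < c" | "x > c" using x by fastforce
      then show "(\<Phi> has_vector_derivative D x *\<^sub>R step c p q x) (at x)"
      proof cases
        case 1
        have "((\<lambda>x. \<phi> x *\<^sub>R p) has_vector_derivative D x *\<^sub>R p) (at x)"
          by (rule bounded_linear.has_vector_derivative[OF bounded_linear_scaleR_left D(1)])
        then have "(\<Phi> has_vector_derivative D x *\<^sub>R p) (at x)"
          by (rule has_vector_derivative_transform_within_open[where S = "{..<c}"])
            (use 1 in \<open>auto simp: \<Phi>_def\<close>)
        then show ?thesis using 1 by (simp add: step_def)
      next
        case 2
        have "((\<lambda>x. \<phi> x *\<^sub>R q + \<phi> c *\<^sub>R (p - q)) has_vector_derivative D x *\<^sub>R q) (at x)"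
          using bounded_linear.has_vector_derivative[OF bounded_linear_scaleR_left D(1), of q x]
          by (simp add: has_vector_derivative_add_const)
        then have "(\<Phi> has_vector_derivative D x *\<^sub>R q) (at x)"
          by (rule has_vector_derivative_transform_within_open[where S = "{c<..}"])
            (use 2 in \<open>auto simp: \<Phi>_def\<close>)
        then show ?thesis using 2 by (simp add: step_def)
      qed
    next
      have "continuous_on ({a..c} \<union> {c..b}) \<Phi>" unfolding \<Phi>_def
        by (intro continuous_on_If continuous_intros continuous_on_subset[OF cont])
          (auto simp: algebra_simps)
      moreover have "{a..c} \<union> {c..b} = {a..b}" using c by auto
      ultimately show "continuous_on {a..b} \<Phi>" by simp
    qed (use c in auto)
    have "\<Phi> b - \<Phi> a = \<phi> c *\<^sub>R (p - q)" using c zero by (simp add: \<Phi>_def)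
    with hi have hi': "integral ?I (\<lambda>x. D x *\<^sub>R step c p q x) = \<phi> c *\<^sub>R (p - q)"
      by (simp add: has_integral_Icc_iff_Ioo integral_unique)
    have fm: "finite_measure (lebesgue_on ?I)"
      by (rule finite_measure_lebesgue_on) simp
    have "bounded (D ` {a..b})"
      using D(2) by (meson compact_Icc compact_continuous_image compact_imp_bounded
          continuous_on_subset subset_UNIV)
    then obtain B where "\<forall>y\<in>D ` {a..b}. norm y \<le> B" unfolding bounded_iff by blast
    then have B: "\<bar>D x\<bar> \<le> B" if "x \<in> {a..b}" for x using that by simp
    have Dm: "D \<in> borel_measurable (lebesgue_on ?I)"
      using D(2) by (intro continuous_imp_measurable_on_sets_lebesgue)
        (auto intro: continuous_on_subset)
    have "integrable (lebesgue_on ?I) (\<lambda>x. D x *\<^sub>R step c p q x)"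
    proof (rule finite_measure.integrable_const_bound[OF fm])
      show "AE x in lebesgue_on ?I. norm (D x *\<^sub>R step c p q x) \<le> B * max (norm p) (norm q)"
      proof (rule AE_I2)
        fix x assume "x \<in> space (lebesgue_on ?I)"
        then have "\<bar>D x\<bar> \<le> B" using B by simp
        moreover have "norm (step c p q x) \<le> max (norm p) (norm q)" by (simp add: step_def)
        ultimately show "norm (D x *\<^sub>R step c p q x) \<le> B * max (norm p) (norm q)"
          by (simp only: norm_scaleR) (intro mult_mono, auto)
      qed
    qed (intro borel_measurable_scaleR Dm step_borel_measurable)
    then have L: "(\<integral>x. deriv \<phi> x *\<^sub>R step c p q x \<partial>lebesgue_on ?I) = \<phi> c *\<^sub>R (p - q)"
      using hi' by (simp add: lebesgue_integral_eq_integral dphi)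
    have m: "\<phi> \<in> borel_measurable (restrict_space borel ?I)"
      by (rule measurable_restrict_space1) simp
    have "(\<integral>x. \<phi> x *\<^sub>R sgn (q - p) \<partial>?n) = (\<integral>x. norm (q - p) *\<^sub>R (\<phi> x *\<^sub>R sgn (q - p)) \<partial>?R)"
      using m by (intro integral_density) auto
    also have "\<dots> = norm (q - p) *\<^sub>R (\<phi> c *\<^sub>R sgn (q - p))"
      using m by (intro integral_return[OF cI]) auto
    also have "\<dots> = \<phi> c *\<^sub>R (q - p)"
      by (cases "p = q") (simp_all add: sgn_div_norm)
    finally show ?thesis unfolding L by (simp add: scaleR_right_diff_distrib)
  qed
  then show ?thesis
    unfolding has_derivative_measure_def using fin unit by auto
qed

lemma step_in_BV_S2:
  fixes p q :: "real^3"
  assumes "norm p = 1" "norm q = 1" "c \<in> {a<..<b}"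
  shows "step c p q \<in> BV_S2 {a<..<b}"
proof -
  have fm: "finite_measure (lebesgue_on {a<..<b})"
    by (rule finite_measure_lebesgue_on) simp
  have "integrable (lebesgue_on {a<..<b}) (step c p q)"
  proof (rule finite_measure.integrable_const_bound[OF fm])
    show "AE x in lebesgue_on {a<..<b}. norm (step c p q x) \<le> 1"
      using assms by (intro AE_I2) (simp add: step_def)
  qed (rule step_borel_measurable)
  then show ?thesis
    using has_derivative_measure_step[OF assms(3), of p q] step_in_L2_S2[OF assms(1,2), of c "{a<..<b}"]
    by (auto simp: BV_S2_def BV_def L2_S2_def)
qed

lemma var_S2_finite:
  assumes "w \<in> BV I" "finite (jump_set I w)"
  shows "var_S2 I w I < \<infinity>"
proof -
  have "\<exists>\<sigma>. has_derivative_measure I w (var_measure I w) \<sigma>"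
    using assms(1) unfolding BV_def var_measure_def by (auto intro: someI_ex[where P = "\<lambda>\<nu>. \<exists>\<sigma>. has_derivative_measure I w \<nu> \<sigma>"])
  then interpret finite_measure "var_measure I w" by (auto simp: has_derivative_measure_def)
  show ?thesis
    using assms(2) by (simp add: var_S2_def diffuse_var_def less_top[symmetric] emeasure_finite)
qed

section \<open>Invariance under orthogonal transformations\<close>

lemma has_derivative_measure_orthogonal:
  assumes R: "orthogonal_transformation R" and w: "has_derivative_measure I w \<nu> \<sigma>"
  shows "has_derivative_measure I (\<lambda>x. R (w x)) \<nu> (\<lambda>x. R (\<sigma> x))"
proof -
  have R': "orthogonal_transformation (inv R)" by (rule orthogonal_transformation_inv[OF R])
  have bl: "bounded_linear R" "bounded_linear (inv R)"
    using R R' by (auto simp: orthogonal_transformation_def linear_conv_bounded_linear)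
  have inv: "inv R (R x) = x" for x
    using orthogonal_transformation_inj[OF R] by (simp add: inv_f_f)
  have lin: "linear R" using R by (simp add: orthogonal_transformation_def)
  have comm: "(\<integral>x. f x *\<^sub>R R (g x) \<partial>M) = R (\<integral>x. f x *\<^sub>R g x \<partial>M)" for f g and M :: "real measure"
    using integral_bounded_linear'[OF bl, of M "\<lambda>x. f x *\<^sub>R g x"] inv
    by (simp add: linear_scale[OF lin])
  have [measurable]: "R \<in> borel_measurable borel"
    using bl(1) by (intro borel_measurable_continuous_onI) (simp add: linear_continuous_on)
  show ?thesis
    using w unfolding has_derivative_measure_def comm
    by (auto simp: linear_neg[OF lin] orthogonal_transformation_norm[OF R])
qed

text \<open>By the preceding lemma for \<open>R\<close> and its inverse, the same measures qualify as total variation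
  measures for \<open>w\<close> and for its image, so the choice in \<open>var_measure\<close> is the same for both.\<close>

lemma diffuse_var_orthogonal:
  assumes R: "orthogonal_transformation R"
  shows "diffuse_var I (\<lambda>x. R (w x)) = diffuse_var I w"
proof -
  have inv: "inv R (R x) = x" for x
    using orthogonal_transformation_inj[OF R] by (simp add: inv_f_f)
  have "(\<exists>\<sigma>. has_derivative_measure I (\<lambda>x. R (w x)) \<nu> \<sigma>) \<longleftrightarrow>
      (\<exists>\<sigma>. has_derivative_measure I w \<nu> \<sigma>)" for \<nu>
    using has_derivative_measure_orthogonal[OF R, of I w \<nu>]
      has_derivative_measure_orthogonal[OF orthogonal_transformation_inv[OF R], of I "\<lambda>x. R (w x)" \<nu>]
    by (auto simp: inv)
  then show ?thesis by (simp add: diffuse_var_def var_measure_def fun_eq_iff)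
qed

lemma var_S2_step_orthogonal:
  assumes R: "orthogonal_transformation R" and c: "c \<in> {a<..<b}" and "p \<noteq> q"
  shows "var_S2 {a<..<b} (step c (R p) (R q)) = var_S2 {a<..<b} (step c p q)"
proof -
  have ne: "R p \<noteq> R q"
    using \<open>p \<noteq> q\<close> orthogonal_transformation_inj[OF R] by (auto dest: injD)
  have "step c (R p) (R q) = (\<lambda>x. R (step c p q x))" by (auto simp: step_def)
  then have "diffuse_var {a<..<b} (step c (R p) (R q)) = diffuse_var {a<..<b} (step c p q)"
    by (simp add: diffuse_var_orthogonal[OF R])
  moreover have "R p \<bullet> R q = p \<bullet> q" using R by (simp add: orthogonal_transformation_def)
  ultimately show ?thesis
    using c one_sided_limits_AE_step[where w = "step c p q" and a = a and b = b
        and c = c and p = p and q = q and x = c]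
      one_sided_limits_AE_step[where w = "step c (R p) (R q)" and a = a and b = b
        and c = c and p = "R p" and q = "R q" and x = c]
    by (auto simp: var_S2_def fun_eq_iff jump_set_step[OF c \<open>p \<noteq> q\<close>] jump_set_step[OF c ne]
        dist_S2_def intro!: infsum_cong)
qed

section \<open>The counterexample\<close>

theorem proposition3p2:
  fixes a b :: real and I :: "real set"
  assumes "a < b" and "I = {a<..<b}"
  shows "\<exists>w\<^sub>0\<in>BV_rad I.
           \<not> geodesically_semiconvex (L2_S2 I) (dist_L2_S2 I) (constrained_TV I w\<^sub>0)"
proof -
  define c where "c = (a + b) / 2"
  have c: "c \<in> {a<..<b}" using assms(1) by (simp add: c_def)
  have I: "I \<in> lmeasurable" by (simp add: assms(2))
  define e :: "3 \<Rightarrow> real^3" where "e = (\<lambda>i. axis i 1)"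
  have ee: "e 1 \<bullet> e 1 = 1" "e 2 \<bullet> e 2 = 1" "e 3 \<bullet> e 3 = 1"
    "e 1 \<bullet> e 2 = 0" "e 1 \<bullet> e 3 = 0" "e 2 \<bullet> e 3 = 0" "e 2 \<bullet> e 1 = 0" "e 3 \<bullet> e 1 = 0" "e 3 \<bullet> e 2 = 0"
    by (simp_all add: e_def inner_axis_axis)
  \<comment> \<open>Orthogonality of \<open>p\<close> to its mirror image forces the latitude \<open>pi / 4\<close>.\<close>
  define p q where "p = (1 / sqrt 2) *\<^sub>R (e 1 + e 3)" and "q = (1 / sqrt 2) *\<^sub>R (e 2 + e 3)"
  define R :: "real^3 \<Rightarrow> real^3" where "R = (\<lambda>x. x - (2 * (x \<bullet> e 3)) *\<^sub>R e 3)"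
  have R: "orthogonal_transformation R"
    unfolding orthogonal_transformation_def
  proof (intro conjI allI)
    show "linear R" by (rule linearI) (simp_all add: R_def inner_add_left algebra_simps)
    show "R x \<bullet> R y = x \<bullet> y" for x y
      by (simp add: R_def inner_diff_left inner_diff_right ee inner_commute)
  qed
  have Rp: "R p = (1 / sqrt 2) *\<^sub>R (e 1 - e 3)" and Rq: "R q = (1 / sqrt 2) *\<^sub>R (e 2 - e 3)"
    by (simp_all add: R_def p_def q_def inner_add_left ee algebra_simps
        flip: scaleR_add_left)
  have np: "norm p = 1" "norm q = 1"
    unfolding norm_eq_1 by (simp_all add: p_def q_def inner_add_left inner_add_right ee)
  have nRp: "norm (R p) = 1" "norm (R q) = 1"
    by (simp_all add: orthogonal_transformation_norm[OF R] np)
  have pq: "p \<bullet> q = 1 / 2"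
    by (simp add: p_def q_def inner_add_left inner_add_right ee)
  have dpq: "dist_S2 p q = pi / 3"
    using arccos_cos[of "pi / 3"] by (simp add: dist_S2_def pq cos_60)
  have ne: "p \<noteq> q" using pq np by (auto simp: norm_eq_1)
  have e12: "e 1 \<noteq> e 2" "dist_S2 (e 1) (e 2) = pi / 2"
    using ee by (auto simp: dist_S2_def)
  have orth: "p \<bullet> R p = 0" "q \<bullet> R q = 0"
    unfolding Rp Rq by (simp_all add: p_def q_def inner_add_left inner_diff_right ee)
  have mid: "(1 / sqrt 2) *\<^sub>R (p + R p) = e 1" "(1 / sqrt 2) *\<^sub>R (q + R q) = e 2"
    unfolding Rp Rq
    by (simp_all add: p_def q_def algebra_simps flip: scaleR_add_left)
  define u v where "u = step c p q" and "v = step c (R p) (R q)"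
  have lim_u: "left_lim u x = (if x \<le> c then p else q)" "right_lim u x = (if x < c then p else q)"
    if "x \<in> I" for x
    using one_sided_limits_AE_step[where w = u and a = a and b = b and c = c and p = p and q = q
        and x = x] that by (auto simp: u_def assms(2))
  have uBV: "u \<in> BV_S2 I" and vBV: "v \<in> BV_S2 I"
    unfolding u_def v_def assms(2) using np nRp c by (auto intro: step_in_BV_S2)
  have L2: "u \<in> L2_S2 I" "v \<in> L2_S2 I"
    unfolding u_def v_def using np nRp by (auto intro: step_in_L2_S2)
  have rad: "u \<in> BV_rad I"
  proof -
    have "dist_S2 p q < pi" using dpq pi_gt_zero by linarith
    moreover have "dist_S2 p p = 0" "dist_S2 q q = 0"
      using np by (simp_all add: dist_S2_def norm_eq_1)
    ultimately have "dist_S2 (left_lim u x) (right_lim u x) < pi" if "x \<in> I" for x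
      using that by (simp add: lim_u)
    then show ?thesis using uBV by (simp add: BV_rad_def)
  qed
  have var_eq: "var_S2 I v = var_S2 I u"
    unfolding u_def v_def assms(2) by (rule var_S2_step_orthogonal[OF R c ne])
  have "var_S2 I u I < \<infinity>"
    using uBV by (intro var_S2_finite) (auto simp: BV_S2_def u_def assms(2) jump_set_step[OF c ne])
  then obtain r where r: "0 \<le> r" "var_S2 I u I = ennreal r" by (cases "var_S2 I u I") auto
  have Fu: "constrained_TV I u u = ereal r" and Fv: "constrained_TV I u v = ereal r"
    using uBV vBV r by (simp_all add: constrained_TV_def var_eq)
  have "\<not> geodesically_semiconvex (L2_S2 I) (dist_L2_S2 I) (constrained_TV I u)"
  proof
    assume "geodesically_semiconvex (L2_S2 I) (dist_L2_S2 I) (constrained_TV I u)"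
    then obtain lam \<gamma> where \<gamma>: "constant_speed_geodesic (L2_S2 I) (dist_L2_S2 I) \<gamma>"
        "\<gamma> 0 = u" "\<gamma> 1 = v"
      and conv: "\<And>t. t \<in> {0..1} \<Longrightarrow> constrained_TV I u (\<gamma> t) \<le>
          ereal (1 - t) * constrained_TV I u u + ereal t * constrained_TV I u v
          - ereal (1 / 2 * lam * t * (1 - t) * (dist_L2_S2 I u v)\<^sup>2)"
      unfolding geodesically_semiconvex_def geodesically_convex_def using L2 by metis
    define m where "m = \<gamma> (1 / 2)"
    have m: "m \<in> L2_S2 I"
      using \<gamma>(1) by (auto simp: constant_speed_geodesic_def m_def)
    have d: "dist_L2_S2 I (\<gamma> s) (\<gamma> t) = \<bar>t - s\<bar> * dist_L2_S2 I u v"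
      if "s \<in> {0..1}" "t \<in> {0..1}" for s t
      using \<gamma> that by (auto simp: constant_speed_geodesic_def)
    have um: "dist_L2_S2 I u m = dist_L2_S2 I u v / 2"
      using d[of 0 "1 / 2"] \<gamma>(2) by (simp add: m_def)
    have mv: "dist_L2_S2 I m v = dist_L2_S2 I u v / 2"
      using d[of "1 / 2" 1] \<gamma>(3) by (simp add: m_def)
    have "AE x in lebesgue_on I. u x \<bullet> v x = 0"
      by (intro AE_I2) (auto simp: u_def v_def step_def orth)
    from L2_midpoint_of_orthogonal_maps[OF I L2 m this um mv]
    have "AE x in lebesgue_on I. m x = step c (e 1) (e 2) x"
      by eventually_elim (auto simp: u_def v_def step_def mid)
    then have lim_m: "left_lim m c = e 1" "right_lim m c = e 2"
      using one_sided_limits_AE_step[where w = m and a = a and b = b and c = c and p = "e 1"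
        and q = "e 2" and x = c] c unfolding assms(2) by simp_all
    have cI: "c \<in> I" using c by (simp add: assms(2))
    have "var_S2 I m {c} = ennreal (pi / 2)" "var_S2 I u {c} = ennreal (pi / 3)"
      using cI e12(1) ne
      by (simp_all add: var_S2_singleton lim_m lim_u flip: e12(2) dpq)
    then have "\<not> var_S2 I m {c} \<le> var_S2 I u {c}" by simp
    then have "constrained_TV I u m = \<infinity>"
      using cI by (auto simp: constrained_TV_def)
    with conv[of "1 / 2"] show False by (simp add: Fu Fv m_def)
  qed
  with rad show ?thesis by blast
qed

end
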